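(* Let $(X,d)$ be a complete and connected metric space with $\mathcal H^1(X)<\infty$, equipped with the measure $\mathcal H^1$. Let $u$ be a function on $X$. If $\mathrm{Var}(u,X)<\infty$, then there exists a function $\widetilde u$ on $X$ with $\widetilde u=u$ a.e. and $$\mathrm{pV}(\widetilde u,X)=\mathrm{Var}(u,X)=\inf\{\mathrm{pV}(v,X):\ v=u\text{ a.e. on }X\}.$$
   Context: $\mathcal H^1$ is the one-dimensional Hausdorff measure; "a.e." is with respect to $\mathcal H^1$. Functions on $X$ are real-valued. A curve is a continuous map from a compact interval to $X$ of finite length; all curves are taken arc-length parametrized. Curves are pairwise disjoint if their images are pairwise disjoint. For a function $v$ on $X$, $$\mathrm{pV}(v,X):=\sup\Big\{\sum_j |v\circ\gamma_j(\ell_j)-v\circ\gamma_j(0)|\Big\},$$ the supremum being over all finite collections of pairwise disjoint injective arc-length parametrized curves $\gamma_j\colon[0,\ell_j]\to X$. Further, $\mathrm{Var}(u,X):=\inf\{\mathrm{pV}(v,X):\ v=u \text{ a.e. on } X\}$. *)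

theory Defs
  imports "HOL-Analysis.Analysis"
begin

section \<open>One-dimensional Hausdorff measure\<close>

text \<open>\<open>diameter\<close> is only meaningful on bounded sets, hence the explicit boundedness condition.\<close>

definition hausdorff1_pre :: "real \<Rightarrow> 'a::metric_space set \<Rightarrow> ennreal" where
  "hausdorff1_pre \<delta> A =
     (INF E \<in> {E :: nat \<Rightarrow> 'a set. (\<forall>i. bounded (E i) \<and> diameter (E i) \<le> \<delta>) \<and> A \<subseteq> (\<Union>i. E i)}.
        \<Sum>i. ennreal (diameter (E i)))"

definition hausdorff1_outer :: "'a::metric_space set \<Rightarrow> ennreal" where
  "hausdorff1_outer A = (SUP \<delta> \<in> {0<..}. hausdorff1_pre \<delta> A)"

text \<open>The measure is the outer measure restricted to its Caratheodory-measurable sets. It is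
  complete, so that \<open>AE\<close> means that the exceptional set has outer measure zero, see
  \<open>AE_hausdorff1_iff\<close> below.\<close>

definition hausdorff1 :: "'a::metric_space measure" where
  "hausdorff1 = measure_of UNIV (lambda_system UNIV UNIV hausdorff1_outer) hausdorff1_outer"

lemma hausdorff1_pre_countably_subadditive:
  assumes "0 < \<delta>"
  shows "hausdorff1_pre \<delta> (\<Union>i. A i) \<le> (\<Sum>i::nat. hausdorff1_pre \<delta> (A i))"
proof (rule ennreal_le_epsilon)
  let ?O = "hausdorff1_pre \<delta> :: 'a set \<Rightarrow> ennreal"
  fix e :: real assume "0 < e" "(\<Sum>n. ?O (A n)) < top"
  then have *: "?O (A n) < ?O (A n) + e * (1/2)^Suc n" for n
    by (auto simp add: less_top dest!: ennreal_suminf_lessD)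
  have "\<exists>E. ((\<forall>i. bounded (E i) \<and> diameter (E i) \<le> \<delta>) \<and> A n \<subseteq> (\<Union>i::nat. E i)) \<and>
      (\<Sum>i. ennreal (diameter (E i))) \<le> ?O (A n) + e * (1/2)^Suc n" for n
  proof -
    have "Inf ((\<lambda>E. \<Sum>i. ennreal (diameter (E i))) `
        {E. (\<forall>i. bounded (E i) \<and> diameter (E i) \<le> \<delta>) \<and> A n \<subseteq> (\<Union>i::nat. E i)})
        < ?O (A n) + e * (1/2)^Suc n"
      using *[of n] unfolding hausdorff1_pre_def .
    then show ?thesis
      unfolding INF_less_iff by (auto intro: less_imp_le)
  qed
  then obtain B where B: "\<And>n i. bounded (B n i) \<and> diameter (B n i) \<le> \<delta>"
      and sub: "\<And>n. A n \<subseteq> (\<Union>i::nat. B n i)"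
      and le: "\<And>n. (\<Sum>i. ennreal (diameter (B n i))) \<le> ?O (A n) + e * (1/2)^Suc n"
    by metis
  define C where "C = case_prod B o prod_decode"
  have C: "bounded (C i) \<and> diameter (C i) \<le> \<delta>" for i
    using B by (auto simp: C_def split_def)
  have A_C: "(\<Union>i. A i) \<subseteq> (\<Union>i. C i)"
    using sub by (auto simp add: C_def subset_eq) (metis prod.case prod_encode_inverse)
  have "?O (\<Union>i. A i) \<le> (\<Sum>i. ennreal (diameter (C i)))"
    unfolding hausdorff1_pre_def using C A_C by (intro INF_lower) auto
  also have "\<dots> = (\<Sum>n. \<Sum>i. ennreal (diameter (B n i)))"
    unfolding C_def comp_def
    by (subst suminf_ennreal_2dimen[where f = "\<lambda>(m, n). ennreal (diameter (B m n))", symmetric])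
       (auto simp: split_def)
  also have "\<dots> \<le> (\<Sum>n. ?O (A n) + e * (1/2) ^ Suc n)"
    by (intro suminf_le le) auto
  also have "\<dots> = (\<Sum>n. ?O (A n)) + (\<Sum>n. ennreal e * ennreal ((1/2) ^ Suc n))"
    using \<open>0 < e\<close> by (subst suminf_add[symmetric])
      (auto simp del: ennreal_suminf_cmult simp add: ennreal_mult[symmetric])
  also have "\<dots> = (\<Sum>n. ?O (A n)) + e"
    unfolding ennreal_suminf_cmult
    by (subst suminf_ennreal_eq[OF zero_le_power power_half_series]) auto
  finally show "?O (\<Union>i. A i) \<le> (\<Sum>n. ?O (A n)) + e" .
qed

lemma hausdorff1_outer_empty [simp]: "hausdorff1_outer {} = 0"
proof -
  have "hausdorff1_pre \<delta> ({} :: 'a set) \<le> 0" if "0 < \<delta>" for \<delta>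
    unfolding hausdorff1_pre_def using that by (intro INF_lower2[of "\<lambda>_. {}"]) auto
  then show ?thesis
    unfolding hausdorff1_outer_def by (intro antisym SUP_least) auto
qed

lemma hausdorff1_outer_mono: "A \<subseteq> B \<Longrightarrow> hausdorff1_outer A \<le> hausdorff1_outer B"
  unfolding hausdorff1_outer_def hausdorff1_pre_def
  by (intro SUP_mono' INF_superset_mono) auto

lemma hausdorff1_outer_countably_subadditive:
  "hausdorff1_outer (\<Union>i. A i) \<le> (\<Sum>i::nat. hausdorff1_outer (A i))"
  unfolding hausdorff1_outer_def[of "\<Union>i. A i"]
proof (rule SUP_least)
  fix \<delta> :: real assume \<delta>: "\<delta> \<in> {0<..}"
  have "hausdorff1_pre \<delta> (\<Union>i. A i) \<le> (\<Sum>i. hausdorff1_pre \<delta> (A i))"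
    using \<delta> by (intro hausdorff1_pre_countably_subadditive) auto
  also have "\<dots> \<le> (\<Sum>i. hausdorff1_outer (A i))"
    unfolding hausdorff1_outer_def using \<delta> by (intro suminf_le SUP_upper) auto
  finally show "hausdorff1_pre \<delta> (\<Union>i. A i) \<le> (\<Sum>i. hausdorff1_outer (A i))" .
qed

lemma outer_measure_space_hausdorff1: "outer_measure_space UNIV hausdorff1_outer"
  unfolding outer_measure_space_def positive_def increasing_def countably_subadditive_def
  by (auto intro: hausdorff1_outer_mono hausdorff1_outer_countably_subadditive)

lemma measure_space_hausdorff1:
  "measure_space UNIV (lambda_system UNIV UNIV hausdorff1_outer) hausdorff1_outer"
  using sigma_algebra.caratheodory_lemma[OF sigma_algebra_Pow[of UNIV]]
    outer_measure_space_hausdorff1 by simp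

lemma space_hausdorff1 [simp]: "space hausdorff1 = UNIV"
  by (simp add: hausdorff1_def space_measure_of_conv)

lemma sets_hausdorff1: "sets hausdorff1 = lambda_system UNIV UNIV hausdorff1_outer"
  using measure_space_hausdorff1 unfolding hausdorff1_def measure_space_def
  by (intro sigma_algebra.sets_measure_of_eq) blast

lemma emeasure_hausdorff1:
  assumes "A \<in> sets hausdorff1"
  shows "emeasure hausdorff1 A = hausdorff1_outer A"
  using measure_space_hausdorff1 assms[unfolded sets_hausdorff1]
  unfolding hausdorff1_def measure_space_def
  by (intro emeasure_measure_of_sigma) blast+

lemma emeasure_hausdorff1_UNIV:
  "emeasure hausdorff1 (UNIV :: 'a::metric_space set) = hausdorff1_outer (UNIV :: 'a set)"
  using emeasure_hausdorff1[of "UNIV :: 'a set"] sets.top[of "hausdorff1 :: 'a measure"] by simp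

lemma null_sets_hausdorff1_iff: "N \<in> null_sets hausdorff1 \<longleftrightarrow> hausdorff1_outer N = 0"
proof
  assume "N \<in> null_sets hausdorff1"
  then show "hausdorff1_outer N = 0"
    using emeasure_hausdorff1[of N] by (auto simp: null_sets_def)
next
  assume N: "hausdorff1_outer N = 0"
  have sa: "hausdorff1_outer x \<le> hausdorff1_outer (N \<inter> x) + hausdorff1_outer ((UNIV - N) \<inter> x)" for x
  proof -
    have "subadditive UNIV (hausdorff1_outer :: 'a set \<Rightarrow> ennreal)"
      using ring_of_sets.countably_subadditive_subadditive[OF ring_of_sets_Pow[of "UNIV :: 'a set"]]
        outer_measure_space_hausdorff1 by (auto simp: outer_measure_space_def)
    then have "hausdorff1_outer ((N \<inter> x) \<union> ((UNIV - N) \<inter> x))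
        \<le> hausdorff1_outer (N \<inter> x) + hausdorff1_outer ((UNIV - N) \<inter> x)"
      by (rule subadditiveD) auto
    moreover have "(N \<inter> x) \<union> ((UNIV - N) \<inter> x) = x" by blast
    ultimately show ?thesis by simp
  qed
  have z: "hausdorff1_outer (N \<inter> x) = 0" for x
    using hausdorff1_outer_mono[of "N \<inter> x" N] N by simp
  have "N \<in> sets hausdorff1"
    unfolding sets_hausdorff1 lambda_system_def
    using sa by (auto simp: z intro: antisym hausdorff1_outer_mono)
  then show "N \<in> null_sets hausdorff1"
    using N emeasure_hausdorff1[of N] by (auto simp: null_sets_def)
qed

lemma AE_hausdorff1_iff: "(AE x in hausdorff1. P x) \<longleftrightarrow> hausdorff1_outer {x. \<not> P x} = 0"
proof
  assume "AE x in hausdorff1. P x"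
  then obtain N where "{x. \<not> P x} \<subseteq> N" "N \<in> null_sets hausdorff1"
    by (auto simp: eventually_ae_filter)
  then show "hausdorff1_outer {x. \<not> P x} = 0"
    using hausdorff1_outer_mono[of "{x. \<not> P x}" N] by (simp add: null_sets_hausdorff1_iff)
next
  assume "hausdorff1_outer {x. \<not> P x} = 0"
  then show "AE x in hausdorff1. P x"
    by (intro AE_I'[of "{x. \<not> P x}"]) (auto simp: null_sets_hausdorff1_iff)
qed


section \<open>Curves\<close>

definition curve_length :: "(real \<Rightarrow> 'a::metric_space) \<Rightarrow> real \<Rightarrow> real \<Rightarrow> ennreal" where
  "curve_length \<gamma> a b =
     (SUP (n, t) \<in> {(n :: nat, t :: nat \<Rightarrow> real). mono_on {..n} t \<and> t 0 = a \<and> t n = b}.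
        \<Sum>i<n. ennreal (dist (\<gamma> (t i)) (\<gamma> (t (Suc i)))))"

text \<open>Finiteness of the length is part of the last condition (take \<open>s = 0\<close> and \<open>t = l\<close>).\<close>

definition arc_length_curve :: "(real \<Rightarrow> 'a::metric_space) \<Rightarrow> real \<Rightarrow> bool" where
  "arc_length_curve \<gamma> l \<longleftrightarrow> 0 \<le> l \<and> continuous_on {0..l} \<gamma> \<and>
     (\<forall>s t. 0 \<le> s \<and> s \<le> t \<and> t \<le> l \<longrightarrow> curve_length \<gamma> s t = ennreal (t - s))"


section \<open>Variation of functions\<close>

definition pV :: "('a::metric_space \<Rightarrow> real) \<Rightarrow> ennreal" where
  "pV v =
     (SUP (n, l, \<gamma>) \<in> {(n :: nat, l :: nat \<Rightarrow> real, \<gamma> :: nat \<Rightarrow> real \<Rightarrow> 'a).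
          (\<forall>j<n. arc_length_curve (\<gamma> j) (l j) \<and> inj_on (\<gamma> j) {0..l j}) \<and>
          disjoint_family_on (\<lambda>j. \<gamma> j ` {0..l j}) {..<n}}.
        \<Sum>j<n. ennreal \<bar>v (\<gamma> j (l j)) - v (\<gamma> j 0)\<bar>)"

definition Var :: "('a::metric_space \<Rightarrow> real) \<Rightarrow> ennreal" where
  "Var u = (INF v \<in> {v. AE x in hausdorff1. v x = u x}. pV v)"

end

theory Submission
  imports Defs
begin

text \<open>A minimising sequence \<open>v i\<close> for \<open>Var u\<close> agrees with \<open>u\<close> off a common null set, and the
  difference of its values at the two ends of a curve is bounded uniformly in \<open>i\<close>. Call two
  points equivalent if \<open>v i x - v i y\<close> is bounded in \<open>i\<close>. Subtracting from \<open>v i\<close> its value at a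
  representative of the class, except on the class where \<open>v i\<close> is itself bounded in \<open>i\<close> (which
  contains the complement of the null set), makes the sequence pointwise bounded without changing
  its pV. By Tychonoff it has a cluster point in the topology of pointwise convergence, for
  which pV is lower semicontinuous, being a supremum of functionals that depend continuously on
  finitely many values.\<close>

lemma pV_ge_single_curve:
  assumes "arc_length_curve \<gamma> l" "inj_on \<gamma> {0..l}"
  shows "ennreal \<bar>v (\<gamma> l) - v (\<gamma> 0)\<bar> \<le> pV v"
  unfolding pV_def
  using assms by (intro SUP_upper2[of "(1, \<lambda>_. l, \<lambda>_. \<gamma>)"]) (auto simp: disjoint_family_on_def)

text \<open>The functions \<open>w i\<close> lie in the product of the compact closures of their
  coordinate ranges. The conclusion says that every neighbourhood of \<open>f\<close> meets the
  sequence frequently; no subsequence is extracted, since an uncountable product of compact sets may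
  fail to be sequentially compact.\<close>

lemma pointwise_bounded_cluster_point:
  fixes w :: "nat \<Rightarrow> 'a \<Rightarrow> real"
  assumes "\<And>x. bounded (range (\<lambda>i. w i x))"
  obtains f where "inf (nhds f) (filtermap w sequentially) \<noteq> bot"
proof -
  define K where "K = (\<Pi>\<^sub>E x\<in>UNIV. closure (range (\<lambda>i. w i x)))"
  have "compactin (product_topology (\<lambda>_. euclidean) UNIV) K"
    unfolding K_def compactin_PiE using assms by simp
  then have "compact K"
    by (simp add: euclidean_product_topology)
  moreover have "w i \<in> K" for i
    using closure_subset by (fastforce simp: K_def PiE_iff)
  ultimately show ?thesis
    using that unfolding compact_filter
    by (metis (mono_tags, lifting) always_eventually eventually_filtermap filtermap_bot_iff
        sequentially_bot)
qed

lemma cluster_point_closed: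
  assumes "inf (nhds f) (filtermap w F) \<noteq> bot" and "closed S" and "\<forall>\<^sub>F i in F. w i \<in> S"
  shows "f \<in> S"
proof (rule ccontr)
  assume "f \<notin> S"
  then have "\<forall>\<^sub>F g in nhds f. g \<in> - S"
    using \<open>closed S\<close> by (intro eventually_nhds_in_open) auto
  moreover have "\<forall>\<^sub>F g in filtermap w F. g \<in> S"
    using assms(3) by (simp add: eventually_filtermap)
  ultimately have "\<forall>\<^sub>F g in inf (nhds f) (filtermap w F). False"
    unfolding eventually_inf by blast
  with assms(1) show False
    by (simp add: eventually_False)
qed

lemma closed_endpoint_sums_le:
  fixes a b :: "nat \<Rightarrow> 'a"
  shows "closed {g :: 'a \<Rightarrow> real. (\<Sum>j<n. \<bar>g (b j) - g (a j)\<bar>) \<le> C}"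
  by (intro closed_Collect_le continuous_on_const continuous_on_sum continuous_on_rabs
      continuous_on_diff continuous_on_product_coordinates)

text \<open>A fixed family of curves involves finitely many values of the function, so its sum being
  at most \<open>C\<close> is a closed condition for pointwise convergence and passes to cluster
  points.\<close>

lemma pV_cluster_point_le:
  fixes w :: "nat \<Rightarrow> 'a::metric_space \<Rightarrow> real"
  assumes cluster: "inf (nhds f) (filtermap w sequentially) \<noteq> bot"
    and le: "\<forall>\<^sub>F i in sequentially. pV (w i) \<le> ennreal C" and "0 \<le> C"
  shows "pV f \<le> ennreal C"
  unfolding pV_def[of f]
proof (intro SUP_least, clarify)
  fix n :: nat and l :: "nat \<Rightarrow> real" and \<gamma> :: "nat \<Rightarrow> real \<Rightarrow> 'a"
  assume *: "\<forall>j<n. arc_length_curve (\<gamma> j) (l j) \<and> inj_on (\<gamma> j) {0..l j}"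
    "disjoint_family_on (\<lambda>j. \<gamma> j ` {0..l j}) {..<n}"
  define S where "S g = (\<Sum>j<n. \<bar>g (\<gamma> j (l j)) - g (\<gamma> j 0)\<bar>)" for g :: "'a \<Rightarrow> real"
  have S: "(\<Sum>j<n. ennreal \<bar>g (\<gamma> j (l j)) - g (\<gamma> j 0)\<bar>) = ennreal (S g)" for g
    by (simp add: S_def)
  have "ennreal (S g) \<le> pV g" for g
    unfolding pV_def S[symmetric] using * by (intro SUP_upper2[of "(n, l, \<gamma>)"]) auto
  with le have "\<forall>\<^sub>F i in sequentially. w i \<in> {g. S g \<le> C}"
    by (elim eventually_mono) (metis assms(3) ennreal_le_iff mem_Collect_eq order_trans)
  moreover have "closed {g. S g \<le> C}"
    unfolding S_def by (rule closed_endpoint_sums_le)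
  ultimately have "S f \<le> C"
    using cluster_point_closed[OF cluster] by blast
  then show "(\<Sum>j<n. ennreal \<bar>f (\<gamma> j (l j)) - f (\<gamma> j 0)\<bar>) \<le> ennreal C"
    unfolding S by (rule ennreal_leI)
qed

text \<open>Of the three properties, the first preserves values almost everywhere, the second
  preserves pV, and the third provides the compactness.\<close>

lemma pointwise_bounded_correction:
  fixes v :: "nat \<Rightarrow> 'a \<Rightarrow> real"
  obtains c :: "'a \<Rightarrow> nat \<Rightarrow> real"
  where "\<And>x. bounded (range (\<lambda>i. v i x)) \<Longrightarrow> c x = (\<lambda>_. 0)"
    and "\<And>x y. bounded (range (\<lambda>i. v i x - v i y)) \<Longrightarrow> c x = c y"
    and "\<And>x. bounded (range (\<lambda>i. v i x - c x i))"
proof -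
  define E where "E x y \<longleftrightarrow> bounded (range (\<lambda>i. v i x - v i y))" for x y
  define B where "B x \<longleftrightarrow> bounded (range (\<lambda>i. v i x))" for x
  define c where "c x = (\<lambda>i. if B x then 0 else v i (SOME y. E x y))" for x
  have E_refl: "E x x" for x
    by (simp add: E_def image_constant_conv)
  have E_sym: "E y x" if "E x y" for x y
    using that unfolding E_def bounded_iff by (auto simp: abs_minus_commute)
  have E_trans: "E x z" if "E x y" "E y z" for x y z
    using bounded_plus_comp[of "\<lambda>i. v i x - v i y" UNIV "\<lambda>i. v i y - v i z"] that
    by (simp add: E_def)
  have B_E: "B x" if "E x y" "B y" for x y
    using bounded_plus_comp[of "\<lambda>i. v i x - v i y" UNIV "\<lambda>i. v i y"] that
    by (simp add: E_def B_def)
  have "c x = c y" if "E x y" for x y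
  proof -
    \<comment> \<open>Equal predicates make \<open>SOME\<close> choose the same representative for
      \<open>x\<close> and \<open>y\<close>.\<close>
    have "E x = E y" using that E_sym E_trans by blast
    moreover have "B x \<longleftrightarrow> B y" using that B_E E_sym by blast
    ultimately show ?thesis unfolding c_def by (simp only:)
  qed
  moreover have "bounded (range (\<lambda>i. v i x - c x i))" for x
    using someI[of "E x", OF E_refl]
    by (cases "B x") (simp_all add: c_def B_def[symmetric] E_def[symmetric])
  ultimately show ?thesis
    by (intro that[of c]) (auto simp: c_def B_def E_def)
qed

text \<open>Only differences between the two ends of a curve enter pV, and there \<open>c\<close>
  cancels.\<close>

lemma pV_subtract:
  assumes "\<And>\<gamma> l. arc_length_curve \<gamma> l \<Longrightarrow> inj_on \<gamma> {0..l} \<Longrightarrow> c (\<gamma> l) = c (\<gamma> 0)"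
  shows "pV (\<lambda>x. v x - c x) = pV v"
  unfolding pV_def
  by (intro SUP_cong refl) (auto intro!: sum.cong simp: assms simp del: sum_ennreal)

lemma Var_minimising_sequence:
  assumes "Var u < \<infinity>"
  obtains v where "\<And>i::nat. AE x in hausdorff1. v i x = u x"
    and "\<And>i. pV (v i) \<le> Var u + ennreal (1 / Suc i)"
proof -
  have "\<exists>v. (AE x in hausdorff1. v x = u x) \<and> pV v \<le> Var u + ennreal (1 / Suc i)" for i
  proof -
    \<comment> \<open>Strict because \<open>Var u\<close> is finite.\<close>
    have "Var u < Var u + ennreal (1 / Suc i)"
      using assms
      by (cases "Var u")
        (auto simp: ennreal_plus[symmetric] ennreal_less_iff simp del: ennreal_plus)
    then show ?thesis
      unfolding Var_def INF_less_iff by (auto intro: less_imp_le)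
  qed
  then show ?thesis using that by metis
qed

lemma Var_attained:
  fixes u :: "'a::metric_space \<Rightarrow> real"
  assumes fin: "Var u < \<infinity>"
  obtains f where "AE x in hausdorff1. f x = u x" and "pV f = Var u"
proof -
  obtain v where v_ae: "\<And>i::nat. AE x in hausdorff1. v i x = u x"
    and v_pV: "\<And>i. pV (v i) \<le> Var u + ennreal (1 / Suc i)"
    using Var_minimising_sequence[OF fin] by blast
  obtain V where V: "Var u = ennreal V" "0 \<le> V"
    using fin by (cases "Var u") auto
  have pV_le: "pV (v i) \<le> ennreal (V + 1 / Suc i)" for i
    using v_pV[of i] V by (simp add: ennreal_plus)
  obtain c where c_zero: "\<And>x. bounded (range (\<lambda>i. v i x)) \<Longrightarrow> c x = (\<lambda>_. 0)"
    and c_eq: "\<And>x y. bounded (range (\<lambda>i. v i x - v i y)) \<Longrightarrow> c x = c y"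
    and c_bdd: "\<And>x. bounded (range (\<lambda>i. v i x - c x i))"
    using pointwise_bounded_correction[of v] by blast
  \<comment> \<open>A single curve is an admissible family, so its end difference is at most
    \<open>V + 1\<close> for every \<open>i\<close>, and its ends are equivalent.\<close>
  have c_curve: "c (\<gamma> l) = c (\<gamma> 0)" if "arc_length_curve \<gamma> l" "inj_on \<gamma> {0..l}" for \<gamma> l
  proof (rule c_eq, rule boundedI, safe)
    fix i
    have "ennreal \<bar>v i (\<gamma> l) - v i (\<gamma> 0)\<bar> \<le> ennreal (V + 1 / Suc i)"
      using pV_ge_single_curve[OF that] pV_le order_trans by blast
    then have "\<bar>v i (\<gamma> l) - v i (\<gamma> 0)\<bar> \<le> V + 1 / Suc i"
      using V by (subst (asm) ennreal_le_iff) auto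
    also have "\<dots> \<le> V + 1" by simp
    finally show "norm (v i (\<gamma> l) - v i (\<gamma> 0)) \<le> V + 1" by simp
  qed
  define w where "w i x = v i x - c x i" for i x
  have w_pV: "pV (w i) = pV (v i)" for i
    unfolding w_def using c_curve by (intro pV_subtract) simp
  obtain f where f: "inf (nhds f) (filtermap w sequentially) \<noteq> bot"
    using pointwise_bounded_cluster_point[of w] c_bdd unfolding w_def by blast
  have "AE x in hausdorff1. \<forall>i. v i x = u x"
    using v_ae by (simp add: AE_all_countable)
  then have f_ae: "AE x in hausdorff1. f x = u x"
  proof eventually_elim
    case (elim x)
    \<comment> \<open>Here \<open>v i x\<close> is constant in \<open>i\<close>, hence bounded, so
      \<open>w i x = u x\<close> for all \<open>i\<close>.\<close>
    then have "c x = (\<lambda>_. 0)" by (intro c_zero) (simp add: image_constant_conv)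
    then have "\<forall>\<^sub>F i in sequentially. w i \<in> {g. g x = u x}"
      using elim by (simp add: w_def)
    moreover have "closed {g :: 'a \<Rightarrow> real. g x = u x}"
      by (intro closed_Collect_eq continuous_on_const continuous_on_product_coordinates)
    ultimately show ?case using cluster_point_closed[OF f] by blast
  qed
  have "pV f \<le> Var u"
  \<comment> \<open>The bounds on \<open>pV (w i)\<close> reach \<open>V\<close> only in the limit,
    whereas the closedness argument needs one level that eventually holds:
    \<open>V + e\<close>.\<close>
  proof (rule ennreal_le_epsilon)
    fix e :: real assume "0 < e"
    have "\<forall>\<^sub>F i in sequentially. 1 / real (Suc i) < e"
      using LIMSEQ_inverse_real_of_nat \<open>0 < e\<close>
      by (auto simp: inverse_eq_divide dest!: order_tendstoD(2))
    then have "\<forall>\<^sub>F i in sequentially. pV (w i) \<le> ennreal (V + e)"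
    proof eventually_elim
      case (elim i)
      then have "ennreal (V + 1 / Suc i) \<le> ennreal (V + e)" by (intro ennreal_leI) simp
      then show ?case unfolding w_pV using pV_le order_trans by blast
    qed
    then have "pV f \<le> ennreal (V + e)"
      using V \<open>0 < e\<close> by (intro pV_cluster_point_le[OF f]) auto
    then show "pV f \<le> Var u + ennreal e"
      using V \<open>0 < e\<close> by (simp add: ennreal_plus)
  qed
  moreover have "Var u \<le> pV f"
    unfolding Var_def using f_ae by (intro INF_lower) simp
  ultimately show ?thesis using that f_ae by (simp add: antisym)
qed

theorem lemma1p1:
  fixes u :: "'a::complete_space \<Rightarrow> real"
  assumes "connected (UNIV :: 'a set)"
    and "emeasure hausdorff1 (UNIV :: 'a set) < \<infinity>"
    and "Var u < \<infinity>"
  shows "\<exists>u' :: 'a \<Rightarrow> real. (AE x in hausdorff1. u' x = u x) \<and>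
           pV u' = Var u \<and>
           Var u = (INF v \<in> {v. AE x in hausdorff1. v x = u x}. pV v)"
  using Var_attained[OF assms(3)] Var_def[of u] by metis

end
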